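(* Let $A=\mathbb{F}_q[t]$, where $q$ is a power of a prime $p$. Let $\wp\in A$ be a monic irreducible polynomial of degree $d$, and let $\theta\in\mathbb{F}_{q^d}$ be a root of $\wp$. Let $a\in A$. The following conditions are equivalent: (0) $\wp$ is $a$-Wieferich, i.e. $a^{q^d}\equiv a \pmod{\wp^2}$; (i) $da/dt\equiv 0\pmod{\wp}$; (i') $(da/dt)|_{t=\theta}=0$; (ii) $Q_{\wp}(a)\equiv 0\pmod{\wp}$; (ii') $Q_{\wp}(a)|_{t=\theta}=0$; (iii) $a^{[1]}|_{t=\theta}=0$.
   Context: For $a\in\mathbb{F}_{q^d}[t]$ (with $t$ an indeterminate), the Fermat quotient is $Q_{\wp}(a):=(a^{q^d}-a)/\wp\in\mathbb{F}_{q^d}[t]$ (this is a polynomial since $\wp$ divides $t^{q^d}-t$), and the difference quotient is $a^{[1]}(t):=(a(t)-a(\theta))/(t-\theta)\in\mathbb{F}_{q^d}[t]$. Congruences modulo $\wp$ are divisibility statements in $\mathbb{F}_{q^d}[t]$ (for elements of $A$, equivalently in $A$). *)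

theory Defs
  imports
    "HOL-Number_Theory.Cong"
    "Subresultants.More_Homomorphisms"
begin

(* In the definitions below q is the cardinality of the base field, while P and a have their
   coefficients in an extension field; q ^ degree P is the exponent q^d. *)

definition wieferich :: "nat \<Rightarrow> 'a::field poly \<Rightarrow> 'a poly \<Rightarrow> bool" where
  "wieferich q P a \<longleftrightarrow> [a ^ (q ^ degree P) = a] (mod P ^ 2)"

(* The division is exact when the coefficient field has q ^ degree P elements and P is the image
   of an irreducible polynomial over the field with q elements, since P then divides X^(q^d) - X. *)
definition fermat_quotient :: "nat \<Rightarrow> 'a::field poly \<Rightarrow> 'a poly \<Rightarrow> 'a poly" where
  "fermat_quotient q P a = (a ^ (q ^ degree P) - a) div P"

definition difference_quotient :: "'a::field \<Rightarrow> 'a poly \<Rightarrow> 'a poly" where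
  "difference_quotient \<theta> a = (a - [:poly a \<theta>:]) div [:- \<theta>, 1:]"

lemma difference_quotient_exact:
  "difference_quotient \<theta> a * [:- \<theta>, 1:] = a - [:poly a \<theta>:]"
proof -
  have "[:- \<theta>, 1:] dvd a - [:poly a \<theta>:]"
    by (rule iffD1 [OF poly_eq_0_iff_dvd]) simp
  then show ?thesis
    by (simp only: difference_quotient_def dvd_div_mult_self)
qed

(* For polynomials over the smaller field, congruence there and over the larger field agree. *)
lemma cong_map_poly_iff:
  fixes \<iota> :: "'k::field \<Rightarrow> 'l::field"
  assumes "field_hom \<iota>"
  shows "[map_poly \<iota> a = map_poly \<iota> b] (mod map_poly \<iota> m) \<longleftrightarrow> [a = b] (mod m)"
proof -
  interpret field_hom \<iota>
    by (fact assms)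
  interpret poly: map_poly_comm_ring_hom \<iota> ..
  show ?thesis
    unfolding cong_iff_dvd_diff poly.hom_minus [symmetric]
    by (auto dest: dvd_map_poly_hom_imp_dvd simp: poly.hom_mult elim!: dvdE [of m])
qed

end

(* Differentiating P * Q = a^N - a, where Q is the Fermat quotient and N = q^d vanishes in the field,
   and evaluating at the root theta gives P'(theta) * Q(theta) = - a'(theta).  Here P'(theta) is
   nonzero because P divides t^N - t, whose derivative is -1.  Hence Q and a' vanish at theta
   simultaneously, and for polynomials over the small field vanishing at theta means divisibility
   by P.  Likewise, differentiating D * (t - theta) = a - a(theta) shows that the difference quotient
   D takes the value a'(theta) at theta. *)
theory Submission
  imports Defs "HOL-Number_Theory.Residues"
begin

text \<open>Multiplication by a nonzero \<open>x\<close> permutes the nonzero elements, so it leaves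
  their product unchanged. Cancelling that product shows that the power of \<open>x\<close> with
  exponent one less than the cardinality is 1.\<close>

lemma power_CARD_field:
  fixes x :: "'a::{field,finite}"
  shows "x ^ card (UNIV :: 'a set) = x"
proof (cases "x = 0")
  case False
  have "x ^ card (UNIV - {0::'a}) * \<Prod>(UNIV - {0}) = (\<Prod>y\<in>UNIV - {0}. x * y)"
    by (simp add: prod.distrib)
  also have "\<dots> = \<Prod>(UNIV - {0})"
    by (rule prod.reindex_bij_witness [where i = "\<lambda>y. y / x" and j = "(*) x"]) (use False in auto)
  finally have "x ^ card (UNIV - {0::'a}) = 1"
    by simp
  moreover have "card (UNIV :: 'a set) = Suc (card (UNIV - {0::'a}))"
    by (rule card_Suc_Diff1 [symmetric]) simp_all
  ultimately show ?thesis
    by (simp only: power_Suc mult_1_right)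
qed (simp add: finite_UNIV_card_ge_0)

lemma of_nat_CARD_eq_0: "of_nat (card (UNIV :: 'a set)) = (0 :: 'a::{ring_1,finite})"
  by (simp add: of_nat_eq_0_iff_char_dvd CHAR_dvd_CARD)

text \<open>The polynomials over the small field that vanish at \<theta> form an ideal, generated by
  a nonzero member \<open>m\<close> of least degree. The irreducible \<open>P\<close> lies in this
  ideal, so it is associated to \<open>m\<close> and generates the ideal as well.\<close>

lemma irreducible_dvd_iff_common_root:
  fixes \<iota> :: "'k::field \<Rightarrow> 'l::field"
  assumes "field_hom \<iota>" and "irreducible P" and root: "poly (map_poly \<iota> P) \<theta> = 0"
  shows "P dvd b \<longleftrightarrow> poly (map_poly \<iota> b) \<theta> = 0"
proof
  interpret field_hom \<iota>
    by (fact assms)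
  interpret poly: map_poly_comm_ring_hom \<iota> ..
  show "poly (map_poly \<iota> b) \<theta> = 0" if "P dvd b"
    using that root by (auto simp: poly.hom_mult)
  have "P \<noteq> 0"
    using \<open>irreducible P\<close> by auto
  then obtain m where m: "m \<noteq> 0" "poly (map_poly \<iota> m) \<theta> = 0"
    and min: "\<And>x. x \<noteq> 0 \<Longrightarrow> poly (map_poly \<iota> x) \<theta> = 0 \<Longrightarrow> degree m \<le> degree x"
    using root ex_has_least_nat
      [where P = "\<lambda>x. x \<noteq> 0 \<and> poly (map_poly \<iota> x) \<theta> = 0" and k = P and m = degree]
    by auto
  \<comment> \<open>The remainder of \<open>x\<close> modulo \<open>m\<close> also vanishes at
    \<theta>, so by minimality of the degree it must be zero.\<close>
  have dvd: "m dvd x" if "poly (map_poly \<iota> x) \<theta> = 0" for x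
  proof (rule ccontr)
    assume "\<not> m dvd x"
    then have "x mod m \<noteq> 0"
      by (simp add: mod_eq_0_iff_dvd)
    moreover have "poly (map_poly \<iota> (x mod m)) \<theta> = 0"
      using that m by (simp add: minus_div_mult_eq_mod [symmetric] poly.hom_minus poly.hom_mult)
    ultimately show False
      using min [of "x mod m"] degree_mod_less' [OF \<open>m \<noteq> 0\<close>, of x] by simp
  qed
  \<comment> \<open>A unit is a nonzero constant, and such a constant has no root.\<close>
  have "\<not> is_unit m"
    proof
    assume "is_unit m"
    then obtain c where "m = [:c:]"
      by (auto simp only: is_unit_poly_iff)
    then show False
      using m by (simp add: map_poly_pCons)
  qed
  then have "P dvd m"
    using dvd [OF root] \<open>irreducible P\<close> irreducibleD' by blast
  then show "P dvd b" if "poly (map_poly \<iota> b) \<theta> = 0"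
    using dvd [OF that] by (rule dvd_trans)
qed

text \<open>The other term of the product rule contains the factor \<open>poly f x\<close>.\<close>

lemma poly_pderiv_mult_at_root:
  fixes f g :: "'a::idom poly"
  assumes "poly f x = 0"
  shows "poly (pderiv (f * g)) x = poly (pderiv f) x * poly g x"
  using assms by (simp add: pderiv_mult)

lemma pderiv_power_minus_self:
  fixes a :: "'a::idom poly"
  assumes "of_nat n = (0 :: 'a)"
  shows "pderiv (a ^ n - a) = - pderiv a"
  using assms by (simp add: pderiv_diff pderiv_power)

lemma poly_difference_quotient_self:
  "poly (difference_quotient \<theta> a) \<theta> = poly (pderiv a) \<theta>"
proof -
  have "poly (pderiv ([:- \<theta>, 1:] * difference_quotient \<theta> a)) \<theta> =
      poly (difference_quotient \<theta> a) \<theta>"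
    by (subst poly_pderiv_mult_at_root) (simp_all add: pderiv_pCons)
  then show ?thesis
    using difference_quotient_exact [of \<theta> a]
    by (simp add: mult.commute pderiv_diff pderiv_pCons del: mult_pCons_left mult_pCons_right)
qed

theorem theorem1:
  fixes p q d :: nat
    and \<iota> :: "'k::{field,finite} \<Rightarrow> 'l::{field,finite}"
    and \<theta> :: 'l
    and P a :: "'k poly"
  assumes "prime p" and "\<exists>m\<ge>1. q = p ^ m"
    and "card (UNIV :: 'k set) = q"
    and "card (UNIV :: 'l set) = q ^ d"
    and "field_hom \<iota>"
    and "lead_coeff P = 1" and "irreducible P" and "degree P = d"
    and "poly (map_poly \<iota> P) \<theta> = 0"
  shows
    "(wieferich q (map_poly \<iota> P) (map_poly \<iota> a)
        \<longleftrightarrow> [map_poly \<iota> (pderiv a) = 0] (mod map_poly \<iota> P))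
   \<and> ([map_poly \<iota> (pderiv a) = 0] (mod map_poly \<iota> P)
        \<longleftrightarrow> poly (map_poly \<iota> (pderiv a)) \<theta> = 0)
   \<and> (poly (map_poly \<iota> (pderiv a)) \<theta> = 0
        \<longleftrightarrow> [fermat_quotient q (map_poly \<iota> P) (map_poly \<iota> a) = 0] (mod map_poly \<iota> P))
   \<and> ([fermat_quotient q (map_poly \<iota> P) (map_poly \<iota> a) = 0] (mod map_poly \<iota> P)
        \<longleftrightarrow> poly (fermat_quotient q (map_poly \<iota> P) (map_poly \<iota> a)) \<theta> = 0)
   \<and> (poly (fermat_quotient q (map_poly \<iota> P) (map_poly \<iota> a)) \<theta> = 0
        \<longleftrightarrow> poly (difference_quotient \<theta> (map_poly \<iota> a)) \<theta> = 0)"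
proof -
  interpret field_hom \<iota>
    by (fact assms)
  interpret poly: map_poly_comm_ring_hom \<iota> ..
  define N where "N = q ^ degree P"
  \<comment> \<open>\<open>F\<close> is the Fermat quotient formed over the small field, where
    \<open>root_iff\<close> can be applied to it.\<close>
  define F where "F = (a ^ N - a) div P"
  let ?m = "map_poly \<iota>"
  have N: "N = card (UNIV :: 'l set)"
    using assms by (simp add: N_def)
  have char: "of_nat N = (0 :: 'l)"
    unfolding N by (rule of_nat_CARD_eq_0)
  have root_iff: "P dvd b \<longleftrightarrow> poly (?m b) \<theta> = 0" for b
    using assms by (intro irreducible_dvd_iff_common_root)
  \<comment> \<open>The value of \<open>b\<close> at \<theta> lies in a field with \<open>N\<close>
    elements, so its \<open>N\<close>-th power is that value again.\<close>
  have P_dvd: "P dvd b ^ N - b" for b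
    by (simp add: root_iff poly.hom_minus poly.hom_power N power_CARD_field)
  have cong_iff: "[?m b = 0] (mod ?m P) \<longleftrightarrow> poly (?m b) \<theta> = 0" for b
    using cong_map_poly_iff [OF \<open>field_hom \<iota>\<close>, of b 0 P] by (simp add: cong_0_iff root_iff)
  \<comment> \<open>The polynomial \<open>b\<close> is kept general: the indeterminate shows that
    the first factor is nonzero, and then \<open>a\<close> gives the equivalence for
    \<open>F\<close>.\<close>
  have deriv: "poly (pderiv (?m P)) \<theta> * poly (?m ((b ^ N - b) div P)) \<theta> =
      - poly (pderiv (?m b)) \<theta>" for b
  proof -
    have "?m P * ?m ((b ^ N - b) div P) = ?m b ^ N - ?m b"
      using P_dvd by (simp flip: poly.hom_mult poly.hom_minus poly.hom_power)
    then show ?thesis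
      using poly_pderiv_mult_at_root [OF \<open>poly (?m P) \<theta> = 0\<close>, of "?m ((b ^ N - b) div P)"]
      by (simp add: pderiv_power_minus_self [OF char])
  qed
  have "poly (pderiv (?m P)) \<theta> \<noteq> 0"
    using deriv [of "[:0, 1:]"] by (auto simp: map_poly_pCons pderiv_pCons)
  then have F_iff: "poly (?m F) \<theta> = 0 \<longleftrightarrow> poly (?m (pderiv a)) \<theta> = 0"
    using deriv [of a] by (auto simp: F_def map_poly_pderiv)
  \<comment> \<open>Division of polynomials commutes with extension of the coefficient
    field.\<close>
  have quot: "fermat_quotient q (?m P) (?m a) = ?m F"
    by (simp add: fermat_quotient_def F_def N_def map_poly_div poly.hom_minus poly.hom_power)
  have "wieferich q (?m P) (?m a) \<longleftrightarrow> [a ^ N = a] (mod P ^ 2)"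
    by (simp add: wieferich_def N_def cong_map_poly_iff [OF \<open>field_hom \<iota>\<close>]
        flip: poly.hom_power)
  also have "\<dots> \<longleftrightarrow> P * P dvd P * F"
    using P_dvd by (simp add: F_def cong_iff_dvd_diff power2_eq_square)
  \<comment> \<open>Cancelling the nonzero \<open>P\<close> leaves \<open>P dvd F\<close>, which
    means vanishing at \<theta>.\<close>
  also have "\<dots> \<longleftrightarrow> poly (?m F) \<theta> = 0"
    using \<open>irreducible P\<close> by (auto simp flip: root_iff)
  finally show ?thesis
    by (simp add: quot cong_iff F_iff poly_difference_quotient_self flip: map_poly_pderiv)
qed

end
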